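(* The exchange relations $$\mathsf W_0\,\mathsf I_{2k+1}=\mathsf I'_{2k+1}\,\mathsf W_0\qquad\text{for all }k\in\mathbb N$$ hold in $\mathcal A_q$ if and only if the parameters satisfy $$\bar\varepsilon_+'=\bar\varepsilon_+,\qquad\bar\varepsilon_-'=\bar\varepsilon_-=0,\qquad\frac{\bar k_+}{k_+}=\frac{\bar k_-}{k_-}q^{-2},\qquad\bar k_\pm'=\bar k_\pm q^{\pm2}.$$
   Context: $q\in\mathbb C^*$ is not a root of unity, $\mathbb N=\{0,1,\dots\}$, $[X,Y]_q=qXY-q^{-1}YX$. Fix $k_\pm\in\mathbb C^*$, $\rho=k_+k_-(q+q^{-1})^2$. $\mathcal A_q$ is the unital associative $\mathbb C$-algebra generated by $\mathsf W_{-k},\mathsf W_{k+1},\mathsf G_{k+1},\tilde{\mathsf G}_{k+1}$ ($k\in\mathbb N$) with, for all $k,l\in\mathbb N$: $[\mathsf W_0,\mathsf W_{k+1}]=[\mathsf W_{-k},\mathsf W_1]=\frac{\tilde{\mathsf G}_{k+1}-\mathsf G_{k+1}}{q+q^{-1}}$; $[\mathsf W_0,\mathsf G_{k+1}]_q=[\tilde{\mathsf G}_{k+1},\mathsf W_0]_q=\rho(\mathsf W_{-k-1}-\mathsf W_{k+1})$; $[\mathsf G_{k+1},\mathsf W_1]_q=[\mathsf W_1,\tilde{\mathsf G}_{k+1}]_q=\rho(\mathsf W_{k+2}-\mathsf W_{-k})$; $[\mathsf W_{-k},\mathsf W_{-l}]=[\mathsf W_{k+1},\mathsf W_{l+1}]=[\mathsf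 G_{k+1},\mathsf G_{l+1}]=[\tilde{\mathsf G}_{k+1},\tilde{\mathsf G}_{l+1}]=0$; $[\mathsf W_{-k},\mathsf W_{l+1}]+[\mathsf W_{k+1},\mathsf W_{-l}]=0$; $[\mathsf W_{-k},\mathsf G_{l+1}]+[\mathsf G_{k+1},\mathsf W_{-l}]=0$; $[\mathsf W_{-k},\tilde{\mathsf G}_{l+1}]+[\tilde{\mathsf G}_{k+1},\mathsf W_{-l}]=0$; $[\mathsf W_{k+1},\mathsf G_{l+1}]+[\mathsf G_{k+1},\mathsf W_{l+1}]=0$; $[\mathsf W_{k+1},\tilde{\mathsf G}_{l+1}]+[\tilde{\mathsf G}_{k+1},\mathsf W_{l+1}]=0$; $[\tilde{\mathsf G}_{k+1},\mathsf G_{l+1}]+[\mathsf G_{k+1},\tilde{\mathsf G}_{l+1}]=0$. (Known fact: $\mathcal A_q$ has a PBW basis in these generators for the order $\mathsf W_{-k}<\mathsf G_{\ell+1}<\tilde{\mathsf G}_{m+1}<\mathsf W_{n+1}$.) For $\bar\varepsilon_\pm,\bar k_\pm,\bar\varepsilon_\pm',\bar k_\pm'\in\mathbb C$: $\mathsf I_{2k+1}=\bar\varepsilon_+\mathsf W_{-k}+\bar\varepsilon_-\mathsf W_{k+1}+\frac1{q^2-q^{-2}}\Big(\frac{\bar k_-}{k_-}\mathsf G_{k+1}+\frac{\bar k_+}{k_+}\tilde{\mathsf G}_{k+1}\Big)$ and $\mathsf I'_{2k+1}$ is the same expression with $\bar\varepsilon_\pm,\bar k_\pm$ replaced by $\bar\varepsilon_\pm',\bar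 k_\pm'$. *)

theory Defs
  imports
    Complex_Main
    "HOL-Library.Poly_Mapping"
    "HOL-Algebra.Algebraic_Closure_Type"
begin

(* The free monoid on 'a, written additively so that Poly_Mapping's convolution product
   on "'a word =>0 complex" is the product of the free associative algebra. *)
datatype 'a word = Word (letters: "'a list")

instantiation word :: (type) monoid_add
begin

definition zero_word :: "'a word"
  where "0 = Word []"

definition plus_word :: "'a word \<Rightarrow> 'a word \<Rightarrow> 'a word"
  where "u + v = Word (letters u @ letters v)"

instance
  by standard (auto simp: zero_word_def plus_word_def)

end

(* W n stands for W_n, n any integer: the generators W_{-k} and W_{k+1} (k a natural number)
   together run exactly once through all integer indices.
   G k and Gt k stand for G_{k+1} and tilde-G_{k+1}, so that all indices k are natural numbers. *)
datatype aq_gen = W int | G nat | Gt nat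

type_synonym aq_free = "aq_gen word \<Rightarrow>\<^sub>0 complex"

definition gen :: "aq_gen \<Rightarrow> aq_free"
  where "gen g = Poly_Mapping.single (Word [g]) 1"

(* scalar multiplication in the free algebra: 0 is the empty word *)
definition scal :: "complex \<Rightarrow> aq_free \<Rightarrow> aq_free"  (infixr "\<odot>" 75)
  where "c \<odot> x = Poly_Mapping.single 0 c * x"

lemma lookup_scal: "Poly_Mapping.lookup (c \<odot> x) w = c * Poly_Mapping.lookup x w"
  by (simp add: scal_def mult_map_scale_conv_mult[symmetric] map.rep_eq when_def)

definition comm :: "aq_free \<Rightarrow> aq_free \<Rightarrow> aq_free"
  where "comm x y = x * y - y * x"

definition qcomm :: "complex \<Rightarrow> aq_free \<Rightarrow> aq_free \<Rightarrow> aq_free"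
  where "qcomm q x y = q \<odot> (x * y) - inverse q \<odot> (y * x)"

definition rho :: "complex \<Rightarrow> complex \<Rightarrow> complex \<Rightarrow> complex"
  where "rho q kp km = kp * km * (q + inverse q)\<^sup>2"

(* The defining relations x = y of A_q; kp and km are k_+ and k_-. *)
inductive aq_rel :: "complex \<Rightarrow> complex \<Rightarrow> complex \<Rightarrow> aq_free \<Rightarrow> aq_free \<Rightarrow> bool"
  for q kp km :: complex
where
  W0_W: "aq_rel q kp km
     (comm (gen (W 0)) (gen (W (int k + 1))))
     (inverse (q + inverse q) \<odot> (gen (Gt k) - gen (G k)))"
| W_W1: "aq_rel q kp km
     (comm (gen (W (- int k))) (gen (W 1)))
     (inverse (q + inverse q) \<odot> (gen (Gt k) - gen (G k)))"
| W0_G: "aq_rel q kp km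
     (qcomm q (gen (W 0)) (gen (G k)))
     (rho q kp km \<odot> (gen (W (- int k - 1)) - gen (W (int k + 1))))"
| Gt_W0: "aq_rel q kp km
     (qcomm q (gen (Gt k)) (gen (W 0)))
     (rho q kp km \<odot> (gen (W (- int k - 1)) - gen (W (int k + 1))))"
| G_W1: "aq_rel q kp km
     (qcomm q (gen (G k)) (gen (W 1)))
     (rho q kp km \<odot> (gen (W (int k + 2)) - gen (W (- int k))))"
| W1_Gt: "aq_rel q kp km
     (qcomm q (gen (W 1)) (gen (Gt k)))
     (rho q kp km \<odot> (gen (W (int k + 2)) - gen (W (- int k))))"
| Wm_Wm: "aq_rel q kp km (comm (gen (W (- int k))) (gen (W (- int l)))) 0"
| Wp_Wp: "aq_rel q kp km (comm (gen (W (int k + 1))) (gen (W (int l + 1)))) 0"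
| G_G: "aq_rel q kp km (comm (gen (G k)) (gen (G l))) 0"
| Gt_Gt: "aq_rel q kp km (comm (gen (Gt k)) (gen (Gt l))) 0"
| Wm_Wp: "aq_rel q kp km
     (comm (gen (W (- int k))) (gen (W (int l + 1)))
      + comm (gen (W (int k + 1))) (gen (W (- int l)))) 0"
| Wm_G: "aq_rel q kp km
     (comm (gen (W (- int k))) (gen (G l)) + comm (gen (G k)) (gen (W (- int l)))) 0"
| Wm_Gt: "aq_rel q kp km
     (comm (gen (W (- int k))) (gen (Gt l)) + comm (gen (Gt k)) (gen (W (- int l)))) 0"
| Wp_G: "aq_rel q kp km
     (comm (gen (W (int k + 1))) (gen (G l)) + comm (gen (G k)) (gen (W (int l + 1)))) 0"
| Wp_Gt: "aq_rel q kp km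
     (comm (gen (W (int k + 1))) (gen (Gt l)) + comm (gen (Gt k)) (gen (W (int l + 1)))) 0"
| Gt_G: "aq_rel q kp km
     (comm (gen (Gt k)) (gen (G l)) + comm (gen (G k)) (gen (Gt l))) 0"

abbreviation free_ring :: "aq_free ring"
  where "free_ring \<equiv> ring_of_type_algebra"

definition aq_ideal :: "complex \<Rightarrow> complex \<Rightarrow> complex \<Rightarrow> aq_free set"
  where "aq_ideal q kp km = Idl\<^bsub>free_ring\<^esub> {x - y | x y. aq_rel q kp km x y}"

(* HOL-Algebra ideals are two-sided, and those of the free algebra are closed under scalars
   because the free algebra contains the constants. *)
definition Aq :: "complex \<Rightarrow> complex \<Rightarrow> complex \<Rightarrow> aq_free set ring"
  where "Aq q kp km = free_ring Quot aq_ideal q kp km"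

(* the canonical projection from the free algebra onto A_q *)
definition aq_class :: "complex \<Rightarrow> complex \<Rightarrow> complex \<Rightarrow> aq_free \<Rightarrow> aq_free set"
  where "aq_class q kp km x = aq_ideal q kp km +>\<^bsub>free_ring\<^esub> x"

definition Wq :: "complex \<Rightarrow> complex \<Rightarrow> complex \<Rightarrow> int \<Rightarrow> aq_free set"
  where "Wq q kp km n = aq_class q kp km (gen (W n))"

(* I_{2k+1}; ep, em, bp, bm are bar-epsilon_+, bar-epsilon_-, bar-k_+, bar-k_- *)
definition Iq ::
  "complex \<Rightarrow> complex \<Rightarrow> complex \<Rightarrow> complex \<Rightarrow> complex \<Rightarrow> complex \<Rightarrow> complex \<Rightarrow> nat \<Rightarrow> aq_free set"
  where "Iq q kp km ep em bp bm k = aq_class q kp km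
    (ep \<odot> gen (W (- int k)) + em \<odot> gen (W (int k + 1))
     + (1 / (q powi 2 - q powi (-2))) \<odot> ((bm / km) \<odot> gen (G k) + (bp / kp) \<odot> gen (Gt k)))"

lemma ring_free_ring: "ring free_ring"
proof -
  have "\<exists>y. x + y = 0" for x :: aq_free
    using add.right_inverse by blast
  thus ?thesis
    unfolding ring_of_type_algebra_def using add.right_inverse
    by unfold_locales (auto simp: algebra_simps Units_def)
qed

lemma ideal_aq_ideal: "ideal (aq_ideal q kp km) free_ring"
  unfolding aq_ideal_def
  by (rule ring.genideal_ideal[OF ring_free_ring]) (simp add: ring_of_type_algebra_def)

lemma ring_Aq: "ring (Aq q kp km)"
  unfolding Aq_def by (rule ideal.quotient_is_ring[OF ideal_aq_ideal])

lemma aq_class_ring_hom: "aq_class q kp km \<in> ring_hom free_ring (Aq q kp km)"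
  unfolding Aq_def aq_class_def[abs_def] by (rule ideal.rcos_ring_hom[OF ideal_aq_ideal])

end

theory Submission
  imports Defs
begin

text \<open>
  If the parameters satisfy the stated conditions, then \<open>W\<^sub>0 I\<^sub>2\<^sub>k\<^sub>+\<^sub>1 - I'\<^sub>2\<^sub>k\<^sub>+\<^sub>1 W\<^sub>0\<close> is a linear
  combination of \<open>[W\<^sub>0, W\<^sub>-\<^sub>k]\<close>, which vanishes, and of the two \<open>q\<close>-commutators of \<open>W\<^sub>0\<close> with
  \<open>G\<^sub>k\<^sub>+\<^sub>1\<close> and with its tilde counterpart; the coefficients of these \<open>q\<close>-commutators
  are opposite, and the defining relations equate the two (\<open>exchange_sufficient\<close>).

  For the converse, the relation for \<open>k = 0\<close> is enough, and a PBW basis is not needed: it is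
  enough to have sufficiently many representations of the algebra. For every point \<open>(x1, x2)\<close> of
  the conic \<open>(q x1 - q\<^sup>-\<^sup>1 x2) (q x2 - q\<^sup>-\<^sup>1 x1) = - rho\<close> there is one by upper triangular 2 by 2
  matrices (\<open>tri_gen_rel\<close>). It sends \<open>W\<^sub>0\<close> to the diagonal matrix with entries \<open>x1, x2\<close> and \<open>W\<^sub>1\<close> to
  the matrix with diagonal entries \<open>x2, x1\<close> and upper right entry 1, every other \<open>W\<^sub>n\<close> to the scalar
  \<open>x1 + x2\<close>, and every \<open>G\<close>-generator except the first of each family to 0. The upper left
  and the upper right entry of the image of the exchange relation are polynomial identities in
  \<open>x1\<close> and \<open>x2\<close> (\<open>exchange_entries\<close>). They are evaluated at the points \<open>(\<plusminus>r, 0)\<close> and \<open>(0, \<plusminus>r)\<close> with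
  \<open>r\<^sup>2 = rho\<close> and at \<open>(s, -s)\<close> with \<open>s\<^sup>2 = k\<^sub>+ k\<^sub>-\<close>. The sign changes separate the terms of even and of
  odd degree, and the resulting linear equations force the conditions on the parameters
  because \<open>q\<^sup>4 \<noteq> 1\<close> (\<open>exchange_necessary\<close>).
\<close>

section \<open>Upper triangular matrices\<close>

text \<open>\<open>Tri a b d\<close> is the upper triangular complex 2 by 2 matrix with diagonal
  \<open>a, d\<close> and upper right entry \<open>b\<close>.\<close>

datatype tri = Tri (ul: complex) (ur: complex) (lr: complex)

instantiation tri :: ring_1
begin

definition "0 = Tri 0 0 0"
definition "1 = Tri 1 0 1"
definition "x + y = Tri (ul x + ul y) (ur x + ur y) (lr x + lr y)"
definition "x - y = Tri (ul x - ul y) (ur x - ur y) (lr x - lr y)"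
definition "- x = Tri (- ul x) (- ur x) (- lr x)"
definition "x * y = Tri (ul x * ul y) (ul x * ur y + ur x * lr y) (lr x * lr y)"

instance
  by standard
    (auto simp: zero_tri_def one_tri_def plus_tri_def minus_tri_def uminus_tri_def times_tri_def
      algebra_simps intro: tri.expand)

end

lemmas tri_defs = zero_tri_def one_tri_def plus_tri_def minus_tri_def uminus_tri_def times_tri_def

text \<open>The scalar matrix with diagonal entries \<open>c\<close>.\<close>

definition scalar_tri :: "complex \<Rightarrow> tri"
  where "scalar_tri c = Tri c 0 c"

lemma scalar_tri_simps:
  "scalar_tri 0 = 0" "scalar_tri 1 = 1"
  "scalar_tri (a + b) = scalar_tri a + scalar_tri b"
  "scalar_tri (a * b) = scalar_tri a * scalar_tri b"
  by (simp_all add: scalar_tri_def tri_defs)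

lemma scalar_tri_commute: "x * scalar_tri c = scalar_tri c * x"
  by (simp add: scalar_tri_def tri_defs)

section \<open>Representations of the free algebra\<close>

text \<open>The algebra homomorphism from the free algebra on \<open>'a\<close> to the upper triangular matrices
  that extends an assignment \<open>f\<close> of matrices to the generators.\<close>

definition tri_rep :: "('a \<Rightarrow> tri) \<Rightarrow> ('a word \<Rightarrow>\<^sub>0 complex) \<Rightarrow> tri"
  where "tri_rep f p = (\<Sum>w\<in>Poly_Mapping.keys p.
    scalar_tri (Poly_Mapping.lookup p w) * prod_list (map f (letters w)))"

lemma tri_rep_zero: "tri_rep f 0 = 0"
  by (simp add: tri_rep_def)

lemma tri_rep_add: "tri_rep f (p + r) = tri_rep f p + tri_rep f r"
  unfolding tri_rep_def
  by (rule setsum_keys_plus_distrib) (simp_all add: scalar_tri_simps distrib_right)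

lemma tri_rep_diff: "tri_rep f (p - r) = tri_rep f p - tri_rep f r"
  using tri_rep_add[of f "p - r" r] by simp

lemma tri_rep_sum: "tri_rep f (sum p I) = (\<Sum>i\<in>I. tri_rep f (p i))"
  by (induction I rule: infinite_finite_induct) (simp_all add: tri_rep_zero tri_rep_add)

lemma tri_rep_single:
  "tri_rep f (Poly_Mapping.single w c) = scalar_tri c * prod_list (map f (letters w))"
  by (simp add: tri_rep_def scalar_tri_simps)

lemma sum_monomials:
  "(\<Sum>w\<in>Poly_Mapping.keys p. Poly_Mapping.single w (Poly_Mapping.lookup p w)) = p"
proof (rule poly_mapping_eqI)
  fix v
  show "Poly_Mapping.lookup (\<Sum>w\<in>Poly_Mapping.keys p.
      Poly_Mapping.single w (Poly_Mapping.lookup p w)) v = Poly_Mapping.lookup p v"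
    by (cases "v \<in> Poly_Mapping.keys p")
      (auto simp: lookup_sum lookup_single when_def in_keys_iff if_distrib cong: if_cong)
qed

lemma tri_rep_mult_single:
  "tri_rep f (Poly_Mapping.single u c * Poly_Mapping.single v d) =
    tri_rep f (Poly_Mapping.single u c) * tri_rep f (Poly_Mapping.single v d)"
proof -
  let ?A = "prod_list (map f (letters u))" and ?B = "prod_list (map f (letters v))"
  have "scalar_tri (c * d) * (?A * ?B) = (scalar_tri c * (scalar_tri d * ?A)) * ?B"
    by (simp add: scalar_tri_simps mult.assoc)
  also have "\<dots> = (scalar_tri c * ?A) * (scalar_tri d * ?B)"
    by (simp only: scalar_tri_commute[of ?A d, symmetric] mult.assoc)
  finally show ?thesis
    by (simp add: mult_single tri_rep_single plus_word_def)
qed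

lemma tri_rep_mult: "tri_rep f (p * r) = tri_rep f p * tri_rep f r"
proof -
  let ?m = "\<lambda>p w. Poly_Mapping.single w (Poly_Mapping.lookup p w)"
  let ?P = "Poly_Mapping.keys p" and ?R = "Poly_Mapping.keys r"
  have "tri_rep f (sum (?m p) ?P * sum (?m r) ?R) =
      tri_rep f (sum (?m p) ?P) * tri_rep f (sum (?m r) ?R)"
    by (simp add: sum_product tri_rep_sum tri_rep_mult_single)
  thus ?thesis
    by (simp add: sum_monomials)
qed

lemma tri_rep_gen: "tri_rep f (gen g) = f g"
  by (simp add: gen_def tri_rep_single scalar_tri_simps)

lemma tri_rep_scal: "tri_rep f (c \<odot> p) = scalar_tri c * tri_rep f p"
  by (simp add: scal_def tri_rep_mult tri_rep_single zero_word_def)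

lemmas tri_rep_simps = tri_rep_zero tri_rep_add tri_rep_diff tri_rep_mult tri_rep_gen tri_rep_scal

section \<open>The ideal of relations\<close>

lemma free_ring_simps:
  "carrier free_ring = UNIV" "x \<otimes>\<^bsub>free_ring\<^esub> y = x * y" "x \<oplus>\<^bsub>free_ring\<^esub> y = x + y"
  "\<zero>\<^bsub>free_ring\<^esub> = 0"
  by (simp_all add: ring_of_type_algebra_def)

lemma minus_free_ring: "x \<ominus>\<^bsub>free_ring\<^esub> y = x - y"
proof -
  interpret ring free_ring by (rule ring_free_ring)
  have "\<ominus>\<^bsub>free_ring\<^esub> y = - y"
    by (rule minus_equality) (simp_all add: free_ring_simps)
  thus ?thesis
    by (simp add: a_minus_def free_ring_simps)
qed

lemma aq_class_eq_iff: "aq_class q kp km x = aq_class q kp km y \<longleftrightarrow> x - y \<in> aq_ideal q kp km"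
  using ring.quotient_eq_iff_same_a_r_cos[OF ring_free_ring ideal_aq_ideal, of x y q kp km]
  by (simp add: aq_class_def minus_free_ring free_ring_simps)

lemma aq_class_mult:
  "aq_class q kp km x \<otimes>\<^bsub>Aq q kp km\<^esub> aq_class q kp km y = aq_class q kp km (x * y)"
  using ring_hom_mult[OF aq_class_ring_hom, of x y q kp km] by (simp add: free_ring_simps)

lemma aq_rel_in_ideal:
  assumes "aq_rel q kp km x y"
  shows "x - y \<in> aq_ideal q kp km"
proof -
  have "{x - y | x y. aq_rel q kp km x y} \<subseteq> aq_ideal q kp km"
    unfolding aq_ideal_def by (rule ring.genideal_self[OF ring_free_ring]) (simp add: free_ring_simps)
  thus ?thesis using assms by blast
qed

lemma aq_ideal_add:
  "x \<in> aq_ideal q kp km \<Longrightarrow> y \<in> aq_ideal q kp km \<Longrightarrow> x + y \<in> aq_ideal q kp km"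
  using additive_subgroup.a_closed[OF ideal.axioms(1)[OF ideal_aq_ideal]]
  by (simp add: free_ring_simps)

lemma aq_ideal_scal: "x \<in> aq_ideal q kp km \<Longrightarrow> c \<odot> x \<in> aq_ideal q kp km"
  using ideal.I_l_closed[OF ideal_aq_ideal, of x q kp km "Poly_Mapping.single 0 c"]
  by (simp add: free_ring_simps scal_def)

lemma tri_rep_kernel_ideal: "ideal {p :: aq_free. tri_rep f p = 0} free_ring"
proof (rule idealI[OF ring_free_ring])
  interpret ring free_ring by (rule ring_free_ring)
  let ?K = "{p :: aq_free. tri_rep f p = 0}"
  have "\<ominus>\<^bsub>free_ring\<^esub> x \<in> ?K" if "x \<in> ?K" for x
    using that minus_free_ring[of 0 x] tri_rep_diff[of f 0 x]
    by (simp add: a_minus_def free_ring_simps tri_rep_zero)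
  moreover have "0 \<in> ?K"
    by (simp add: tri_rep_zero)
  moreover have "x \<oplus>\<^bsub>free_ring\<^esub> y \<in> ?K" if "x \<in> ?K" "y \<in> ?K" for x y
    using that by (simp add: free_ring_simps tri_rep_add)
  moreover have "?K \<subseteq> carrier free_ring"
    by (simp add: free_ring_simps)
  ultimately show "subgroup ?K (add_monoid free_ring)"
    by (intro add.subgroupI) blast+
qed (simp_all add: free_ring_simps tri_rep_simps)

text \<open>An assignment of matrices that respects the defining relations induces a representation
  of the quotient algebra.\<close>

lemma tri_rep_vanishes_on_ideal:
  assumes rel: "\<And>x y. aq_rel q kp km x y \<Longrightarrow> tri_rep f x = tri_rep f y"
    and p: "p \<in> aq_ideal q kp km"
  shows "tri_rep f p = 0"
proof -
  have "aq_ideal q kp km \<subseteq> {p. tri_rep f p = 0}"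
    unfolding aq_ideal_def
    by (rule ring.genideal_minimal[OF ring_free_ring tri_rep_kernel_ideal])
      (auto simp: tri_rep_diff rel)
  thus ?thesis using p by blast
qed

section \<open>A family of representations\<close>

text \<open>The images of the generators under the representation attached to \<open>x1\<close> and \<open>x2\<close>. The
  diagonal entry \<open>t\<close> of the images of \<open>G 0\<close> and \<open>Gt 0\<close> is later taken to be
  \<open>rho / (q - q\<^sup>-\<^sup>1)\<close>.\<close>

fun tri_gen :: "complex \<Rightarrow> complex \<Rightarrow> complex \<Rightarrow> complex \<Rightarrow> aq_gen \<Rightarrow> tri"
  where
    "tri_gen q t x1 x2 (W n) =
      (if n = 0 then Tri x1 0 x2 else if n = 1 then Tri x2 1 x1 else scalar_tri (x1 + x2))"
  | "tri_gen q t x1 x2 (G k) = (if k = 0 then Tri t (q * x2 - inverse q * x1) t else 0)"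
  | "tri_gen q t x1 x2 (Gt k) = (if k = 0 then Tri t (q * x1 - inverse q * x2) t else 0)"

text \<open>On the conic the assignment \<open>tri_gen\<close> respects all defining relations. Instances with a
  positive index hold because all \<open>W n\<close> other than \<open>W 0\<close> and \<open>W 1\<close> go to one and the same scalar
  matrix, and all \<open>G k\<close> and \<open>Gt k\<close> with \<open>k > 0\<close> to 0. The commutator of \<open>W 0\<close> and \<open>W 1\<close> accounts
  for the upper right entries of \<open>G 0\<close> and \<open>Gt 0\<close>; the \<open>q\<close>-commutator relations for \<open>k = 0\<close> amount
  to the equation of the conic and to that of \<open>t\<close>.\<close>

lemma tri_gen_rel:
  assumes q: "q \<noteq> 0" "q + inverse q \<noteq> 0"
    and t: "(q - inverse q) * t = rho q kp km"
    and conic: "(q * x1 - inverse q * x2) * (q * x2 - inverse q * x1) = - rho q kp km"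
    and rel: "aq_rel q kp km x y"
  shows "tri_rep (tri_gen q t x1 x2) x = tri_rep (tri_gen q t x1 x2) y"
proof -
  define p where "p = inverse q"
  define u where "u = inverse (q + p)"
  have u: "u * (q + p) = 1"
    using q by (simp add: u_def p_def)
  have commutator: "x1 - x2 = u * (q * x1 - p * x2 - (q * x2 - p * x1))"
  proof -
    have "u * (q * x1 - p * x2 - (q * x2 - p * x1)) = (u * (q + p)) * (x1 - x2)"
      by (simp add: algebra_simps)
    thus ?thesis
      by (simp add: u)
  qed
  note t = t[folded p_def] and conic = conic[folded p_def]
  note simps = comm_def qcomm_def tri_rep_simps scalar_tri_def tri_defs
    p_def[symmetric] u_def[symmetric]
  show ?thesis
    using rel
  proof cases
    case (W0_W k)
    show ?thesis
      unfolding W0_W by (cases "k = 0") (simp_all add: simps commutator[symmetric])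
  next
    case (W_W1 k)
    show ?thesis
      unfolding W_W1 by (cases "k = 0") (simp_all add: simps commutator[symmetric])
  next
    case (W0_G k)
    show ?thesis
      unfolding W0_G by (cases "k = 0") (use conic in \<open>simp_all add: simps t[symmetric] algebra_simps\<close>)
  next
    case (Gt_W0 k)
    show ?thesis
      unfolding Gt_W0 by (cases "k = 0") (use conic in \<open>simp_all add: simps t[symmetric] algebra_simps\<close>)
  next
    case (G_W1 k)
    show ?thesis
      unfolding G_W1 by (cases "k = 0") (use conic in \<open>simp_all add: simps t[symmetric] algebra_simps\<close>)
  next
    case (W1_Gt k)
    show ?thesis
      unfolding W1_Gt by (cases "k = 0") (use conic in \<open>simp_all add: simps t[symmetric] algebra_simps\<close>)
  qed (auto simp: comm_def tri_rep_simps scalar_tri_def tri_defs)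
qed

section \<open>The exchange relation\<close>

text \<open>The element of the free algebra whose class is \<open>I\<^sub>2\<^sub>k\<^sub>+\<^sub>1\<close>; the scalars \<open>gm\<close> and
  \<open>gp\<close> stand for the normalised parameters \<open>bm / km\<close> and \<open>bp / kp\<close>, and \<open>c\<close> for the common factor
  of the last two terms.\<close>

definition current ::
  "complex \<Rightarrow> complex \<Rightarrow> complex \<Rightarrow> complex \<Rightarrow> complex \<Rightarrow> nat \<Rightarrow> aq_free"
  where "current ep em c gm gp k =
    scal ep (gen (W (- int k))) + scal em (gen (W (int k + 1)))
    + scal c (scal gm (gen (G k)) + scal gp (gen (Gt k)))"

lemma exchange_iff:
  "Wq q kp km 0 \<otimes>\<^bsub>Aq q kp km\<^esub> Iq q kp km ep em bp bm k
      = Iq q kp km ep' em' bp' bm' k \<otimes>\<^bsub>Aq q kp km\<^esub> Wq q kp km 0 \<longleftrightarrow>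
    gen (W 0) * current ep em (1 / (q powi 2 - q powi (-2))) (bm / km) (bp / kp) k
    - current ep' em' (1 / (q powi 2 - q powi (-2))) (bm' / km) (bp' / kp) k * gen (W 0)
      \<in> aq_ideal q kp km"
  by (simp add: Wq_def Iq_def aq_class_mult aq_class_eq_iff current_def)

lemma scal_mult_left: "scal c x * y = scal c (x * y)"
  by (simp add: scal_def mult.assoc)

lemma single_0_commute: "x * Poly_Mapping.single 0 c = Poly_Mapping.single 0 c * x"
  for x :: "'a::monoid_add \<Rightarrow>\<^sub>0 complex"
proof -
  let ?m = "\<lambda>w. Poly_Mapping.single w (Poly_Mapping.lookup x w)"
  have "sum ?m (Poly_Mapping.keys x) * Poly_Mapping.single 0 c
      = Poly_Mapping.single 0 c * sum ?m (Poly_Mapping.keys x)"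
    by (simp add: sum_distrib_left sum_distrib_right mult_single mult.commute)
  thus ?thesis by (simp add: sum_monomials)
qed

lemma scal_mult_right: "x * scal c y = scal c (x * y)"
  by (metis scal_def mult.assoc single_0_commute)

text \<open>Here \<open>g\<close> is the common value of \<open>bm / km\<close> and \<open>bp' / kp\<close>.\<close>

lemma exchange_sufficient:
  assumes q: "q \<noteq> 0"
  shows "gen (W 0) * current ep 0 c g (g * q powi (-2)) k
    - current ep 0 c (g * q powi (-2)) g k * gen (W 0) \<in> aq_ideal q kp km" (is "?d \<in> _")
proof -
  let ?R = "scal (rho q kp km) (gen (W (- int k - 1)) - gen (W (int k + 1)))"
  let ?u = "qcomm q (gen (W 0)) (gen (G k))" and ?v = "qcomm q (gen (Gt k)) (gen (W 0))"
  let ?w = "comm (gen (W (- int 0))) (gen (W (- int k)))"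
  have "scal ep (?w - 0)
      + (scal (c * g * inverse q) (?u - ?R) + scal (- (c * g * inverse q)) (?v - ?R))
      \<in> aq_ideal q kp km"
    by (intro aq_ideal_add aq_ideal_scal aq_rel_in_ideal aq_rel.intros)
  moreover have "?d = scal ep (?w - 0)
      + (scal (c * g * inverse q) (?u - ?R) + scal (- (c * g * inverse q)) (?v - ?R))"
  proof (rule poly_mapping_eqI)
    fix w
    \<comment> \<open>\<open>a\<close>, \<open>b\<close>, \<open>a'\<close>, \<open>b'\<close> stand for the coefficients at \<open>w\<close> of \<open>W\<^sub>0 G\<close>, \<open>W\<^sub>0 Gt\<close>, \<open>G W\<^sub>0\<close>, \<open>Gt W\<^sub>0\<close>,
      and \<open>r\<close> for that of the common right-hand side of their \<open>q\<close>-commutators\<close>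
    let ?l = "\<lambda>x :: aq_free. Poly_Mapping.lookup x w"
    have coeffs: "c * (g * a + g * q powi (-2) * b) - c * (g * q powi (-2) * a' + g * b')
        = c * g * inverse q * (q * a - inverse q * a' - r)
          + - (c * g * inverse q) * (q * b' - inverse q * b - r)"
      for a a' b b' r
      using q by (simp add: power_int_minus power2_eq_square algebra_simps)
    show "?l ?d = ?l (scal ep (?w - 0)
        + (scal (c * g * inverse q) (?u - ?R) + scal (- (c * g * inverse q)) (?v - ?R)))"
      using coeffs[of "?l (gen (W 0) * gen (G k))" "?l (gen (W 0) * gen (Gt k))"
          "?l (gen (G k) * gen (W 0))" "?l (gen (Gt k) * gen (W 0))" "?l ?R"]
      by (simp add: current_def comm_def qcomm_def scal_mult_right scal_mult_left distrib_left
          distrib_right lookup_scal lookup_add lookup_minus algebra_simps)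
  qed
  ultimately show ?thesis by simp
qed

text \<open>The upper left and the upper right entry of the image of the exchange relation for
  \<open>k = 0\<close>.\<close>

lemma exchange_entries:
  assumes q: "q \<noteq> 0" "q + inverse q \<noteq> 0"
    and t: "(q - inverse q) * t = rho q kp km"
    and conic: "(q * x1 - inverse q * x2) * (q * x2 - inverse q * x1) = - rho q kp km"
    and mem: "gen (W 0) * current ep em c gm gp 0 - current ep' em' c gm' gp' 0 * gen (W 0)
      \<in> aq_ideal q kp km"
  shows "x1 * (ep * x1 + em * x2 + c * (gm + gp) * t)
      = (ep' * x1 + em' * x2 + c * (gm' + gp') * t) * x1"
    and "x1 * (em + c * (gm * (q * x2 - inverse q * x1) + gp * (q * x1 - inverse q * x2)))
      = (em' + c * (gm' * (q * x2 - inverse q * x1) + gp' * (q * x1 - inverse q * x2))) * x2"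
  using tri_rep_vanishes_on_ideal[OF tri_gen_rel[OF q t conic] mem]
  by (simp_all add: current_def tri_rep_simps scalar_tri_def tri_defs algebra_simps)

lemma exchange_necessary:
  assumes q: "q \<noteq> 0" "q ^ 4 \<noteq> 1"
    and k: "kp \<noteq> 0" "km \<noteq> 0" and c: "c \<noteq> 0"
    and mem: "gen (W 0) * current ep em c gm gp 0 - current ep' em' c gm' gp' 0 * gen (W 0)
      \<in> aq_ideal q kp km"
  shows "ep' = ep" "em' = 0" "em = 0" "gm = q\<^sup>2 * gp" "gp' = q\<^sup>2 * gp" "gm' = gp"
proof -
  have "(q\<^sup>2 - 1) * (q\<^sup>2 + 1) = q ^ 4 - 1"
    by (simp add: algebra_simps power2_eq_square power4_eq_xxxx)
  with q(2) have "(q\<^sup>2 - 1) * (q\<^sup>2 + 1) \<noteq> 0" by simp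
  hence q2: "q\<^sup>2 - 1 \<noteq> 0" and q2': "q\<^sup>2 + 1 \<noteq> 0"
    using mult_eq_0_iff by blast+
  have fractions: "q + inverse q = (q\<^sup>2 + 1) / q" "q - inverse q = (q\<^sup>2 - 1) / q"
    using q(1)
    by (simp_all add: power2_eq_square add_divide_distrib diff_divide_distrib inverse_eq_divide)
  have qq: "q + inverse q \<noteq> 0" and qq': "q - inverse q \<noteq> 0"
    unfolding fractions using q(1) q2 q2' by simp_all
  define t where "t = rho q kp km / (q - inverse q)"
  have t: "(q - inverse q) * t = rho q kp km" using qq' by (simp add: t_def)
  define r where "r = csqrt (rho q kp km)"
  define s where "s = csqrt (kp * km)"
  have r: "r * r = rho q kp km" and s: "s * s = kp * km"
    using power2_csqrt by (simp_all add: r_def s_def power2_eq_square[symmetric])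
  have r0: "r \<noteq> 0" using r k qq by (auto simp: rho_def)
  have s0: "s \<noteq> 0" using s k by auto
  note entries = exchange_entries[OF q(1) qq t _ mem]
  \<comment> \<open>the points \<open>(r, 0)\<close>, \<open>(-r, 0)\<close>, \<open>(0, r)\<close>, \<open>(0, -r)\<close> and \<open>(s, -s)\<close> lie on the conic\<close>
  have conic: "(q * r - inverse q * 0) * (q * 0 - inverse q * r) = - rho q kp km"
    "(q * (- r) - inverse q * 0) * (q * 0 - inverse q * (- r)) = - rho q kp km"
    "(q * 0 - inverse q * r) * (q * r - inverse q * 0) = - rho q kp km"
    "(q * 0 - inverse q * (- r)) * (q * (- r) - inverse q * 0) = - rho q kp km"
    using q(1) by (simp_all add: r[symmetric] field_simps)
  have conic': "(q * s - inverse q * (- s)) * (q * (- s) - inverse q * s) = - rho q kp km"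
    unfolding rho_def s[symmetric] using q(1) by (simp add: power2_eq_square algebra_simps)
  \<comment> \<open>used to separate the odd from the even part of an identity that holds at opposite points\<close>
  have zero: "x = 0" if "x + y = 0" "x - y = 0" for x y :: complex
  proof -
    have "x = y" using that(2) by simp
    with that(1) have "2 * x = 0" by simp
    thus ?thesis by simp
  qed
  show "ep' = ep"
  proof -
    let ?y = "c * (gm + gp) * t - c * (gm' + gp') * t"
    have "ep * r + c * (gm + gp) * t = ep' * r + c * (gm' + gp') * t"
      using entries(1)[OF conic(1)] r0 by simp
    hence "(ep - ep') * r + ?y = 0" by (simp add: algebra_simps)
    moreover have "- (ep * r) + c * (gm + gp) * t = - (ep' * r) + c * (gm' + gp') * t"
      using entries(1)[OF conic(2)] r0 by simp
    hence "(ep - ep') * r - ?y = 0" by (simp add: algebra_simps)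
    ultimately have "(ep - ep') * r = 0" by (rule zero)
    with r0 show ?thesis by simp
  qed
  have a: "em + c * r * (gp * q - gm * inverse q) = 0" "em - c * r * (gp * q - gm * inverse q) = 0"
    using entries(2)[OF conic(1)] entries(2)[OF conic(2)] r0 by (auto simp: algebra_simps)
  have b: "em' + c * r * (gm' * q - gp' * inverse q) = 0" "em' - c * r * (gm' * q - gp' * inverse q) = 0"
    using entries(2)[OF conic(3)] entries(2)[OF conic(4)] r0 by (auto simp: algebra_simps)
  show em: "em = 0" using zero[OF a] .
  show em': "em' = 0" using zero[OF b] .
  have "gp * q = gm * inverse q" using a(1) em c r0 by simp
  thus gm: "gm = q\<^sup>2 * gp" using q(1) by (simp add: field_simps power2_eq_square)
  have "gm' * q = gp' * inverse q" using b(1) em' c r0 by simp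
  hence gp': "gp' = q\<^sup>2 * gm'" using q(1) by (simp add: field_simps power2_eq_square)
  \<comment> \<open>at \<open>(s, -s)\<close> the off-diagonal entries of the images of \<open>G 0\<close> and \<open>Gt 0\<close> are opposite\<close>
  have "(c * s * s * (q + inverse q)) * (gp - gm + (gp' - gm')) = 0"
    using entries(2)[OF conic'] by (simp add: em em' algebra_simps)
  hence "gp - gm + (gp' - gm') = 0" using c s0 qq by simp
  hence "(q\<^sup>2 - 1) * (gm' - gp) = 0" by (simp add: gm gp' algebra_simps)
  thus "gm' = gp" using q2 by simp
  with gp' show "gp' = q\<^sup>2 * gp" by simp
qed

theorem proposition6p1:
  fixes q kp km :: complex
    and ep em bp bm ep' em' bp' bm' :: complex
  assumes "q \<noteq> 0"
    and "\<forall>n::nat. n > 0 \<longrightarrow> q ^ n \<noteq> 1"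
    and "kp \<noteq> 0" and "km \<noteq> 0"
  shows "(\<forall>k::nat.
            Wq q kp km 0 \<otimes>\<^bsub>Aq q kp km\<^esub> Iq q kp km ep em bp bm k
            = Iq q kp km ep' em' bp' bm' k \<otimes>\<^bsub>Aq q kp km\<^esub> Wq q kp km 0)
         \<longleftrightarrow>
         (ep' = ep \<and> em' = em \<and> em = 0 \<and> bp / kp = (bm / km) * q powi (-2)
          \<and> bp' = bp * q powi 2 \<and> bm' = bm * q powi (-2))"
  (is "(\<forall>k. ?exchange k) \<longleftrightarrow> ?params")
proof
  let ?c = "1 / (q powi 2 - q powi (-2))"
  assume "\<forall>k. ?exchange k"
  hence "?exchange 0" by blast
  note mem = this[unfolded exchange_iff]
  have q4: "q ^ 4 \<noteq> 1" using assms(2) by simp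
  have "?c \<noteq> 0"
    using assms(1) q4 by (auto simp: power_int_minus field_simps power2_eq_square power4_eq_xxxx)
  note par = exchange_necessary[OF assms(1) q4 assms(3,4) this mem]
  have "bp' = bp * q\<^sup>2" using par(5) assms(3) by (simp add: field_simps)
  moreover have "bm' = (bp / kp) * km" "bm = q\<^sup>2 * (bp / kp) * km"
    using par(4,6) assms(4) by (simp_all add: field_simps)
  ultimately show ?params
    using par(1-3) assms(1,3,4) by (simp add: power_int_minus)
next
  assume p: ?params
  have "bp' / kp = bm / km" "bm' / km = bm / km * q powi (-2)"
    using p assms by (simp_all add: power_int_minus field_simps)
  thus "\<forall>k. ?exchange k"
    unfolding exchange_iff using p exchange_sufficient[OF assms(1), of ep _ "bm / km"] by simp
qed

end
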